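(* Let $A,B,C_1,\dots,C_m\in\mathbb{C}^{n\times n}$, $r_i,s_i\in\mathbb{C}^n$, $g_i\in\mathbb{C}^n\setminus\{0\}$ ($i=1,\dots,m$), let $N_s=\binom{n+m}{m+1}$ (with $n\ge2$, so that $N_s\ge 2$), and let $\Delta_0,\Delta_1\in\mathbb{C}^{n^{m+1}\times n^{m+1}}$ be the operator determinants defined in the context. Suppose that the NEPv $$\Bigl(A+\lambda B+\frac{r_1^Tx}{s_1^Tx}C_1+\cdots+\frac{r_m^Tx}{s_m^Tx}C_m\Bigr)x=0$$ has exactly $N_s$ distinct solutions $(\lambda_j,x_j)$, $j=1,\dots,N_s$, that the pencil $(\Delta_1,\Delta_0)$ is regular and non-defective, and that $\sigma\in\mathbb{C}$ is not an eigenvalue of $(\Delta_1,\Delta_0)$. Order the solutions so that $|\lambda_1-\sigma|\le|\lambda_2-\sigma|\le\cdots\le|\lambda_{N_s}-\sigma|$, so that $\lambda_1$ and $\lambda_2$ are the closest and second closest symmetric eigenvalues to $\sigma$. Let $z_0$ be symmetric with nonzero components in the eigenvectors $x_1\otimes\cdots\otimes x_1$ and $x_2\otimes\cdots\otimes x_2$ in its expansion in the vectors $x_j\otimes\cdots\otimes x_j$, $j=1,\dots,N_s$, and consider inverse iteration $$(\Delta_1-\sigma\Delta_0)\tilde z_{k+1}=\Delta_0z_k,\qquad z_{k+1}=\frac{\tilde z_{k+1}}{\lVert\tilde z_{k+1}\rVert},\qquad k=0,1,2,\dots.$$ Then the convergence rate of the iteration is $\mathcal{O}\left(\left|\frac{\sigma-\lambda_1}{\sigma-\lambda_2}\right|^k\right)$;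 that is, the distance of $z_k$ to the line spanned by $x_1\otimes\cdots\otimes x_1$ is $\mathcal{O}\left(\left|\frac{\sigma-\lambda_1}{\sigma-\lambda_2}\right|^k\right)$ as $k\to\infty$.
   Context: A solution of the NEPv is a pair $(\lambda,x)$ with $\lambda\in\mathbb{C}$, $x\in\mathbb{C}^n\setminus\{0\}$ and $s_i^Tx\neq0$ for all $i$; solutions $(\lambda,x)$ and $(\lambda,\alpha x)$, $\alpha\ne0$, are identified. For a $k\times k$ array of square matrices $D_{i,j}$ (of size depending only on $i$) the operator determinant is $|D_{i,j}|_\otimes=\sum_{\pi\in S_k}\operatorname{sgn}(\pi)\,D_{1,\pi(1)}\otimes D_{2,\pi(2)}\otimes\cdots\otimes D_{k,\pi(k)}$, with $\otimes$ the Kronecker product. $\Delta_0$ is the operator determinant of the $(m+1)\times(m+1)$ array whose first row is $(B,C_1,\dots,C_m)$ and whose row $j+1$ ($j=1,\dots,m$) is $(B,C_1,\dots,C_{j}-g_js_j^T,\dots,C_m)$, i.e. the first row with $C_j$ replaced by $C_j-g_js_j^T$. $\Delta_1$ is obtained from the same array by replacing its first column by $(-A,\,-(A+g_1r_1^T),\dots,-(A+g_mr_m^T))$. The pencil $(\Delta_1,\Delta_0)$ stands for the generalized eigenvalue problem $\Delta_1z=\lambda\Delta_0z$; regular means $\det(\Delta_1-\lambda\Delta_0)\not\equiv0$, non-defective means that there is a basis of eigenvectors. A vector $z\in\mathbb{C}^{n^{m+1}}$ is called symmetric (symmetric decomposable) if $z=\sum_{j}\alpha_j\,x_j\otimes\cdots\otimes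 x_j$ ($m+1$ factors) for finitely many $x_j\in\mathbb{C}^n$, $\alpha_j\in\mathbb{C}$. A symmetric eigenvalue is an eigenvalue belonging to an eigenvector of the form $x\otimes\cdots\otimes x$; here these are the eigenvalues $\lambda_j$ of the NEPv solutions, with $x_j\otimes\cdots\otimes x_j$ as eigenvectors, and they are counted once per solution. *)

theory Defs
  imports "HOL-Analysis.Analysis" "HOL-Library.Landau_Symbols"
begin

text \<open>
  The dimension \<open>n\<close> is \<open>CARD('n)\<close> and the number \<open>m\<close> of nonlinear terms is \<open>CARD('m)\<close>.
  The rows and columns of the \<open>(m+1) \<times> (m+1)\<close> arrays are indexed by \<open>'m option\<close>: \<open>None\<close> is the
  first row (column), \<open>Some j\<close> is row (column) \<open>j + 1\<close>.

  A coordinate of a \<open>k\<close>-fold Kronecker product is given by one index per factor, so the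
  coordinates of \<open>\<complex>\<close>-vectors of length \<open>n\<^sup>k\<close> are indexed by the \<open>n\<^sup>k\<close> functions \<open>'k \<Rightarrow> 'n\<close>
  with \<open>k = CARD('k)\<close>, in place of the lexicographic position of the multi-index.
\<close>

definition kron_mat :: "('k::finite \<Rightarrow> complex^'n::finite^'n) \<Rightarrow> complex^('k \<Rightarrow> 'n)^('k \<Rightarrow> 'n)" where
  "kron_mat M = (\<chi> I J. \<Prod>k\<in>UNIV. M k $ I k $ J k)"

definition kron_vec :: "('k::finite \<Rightarrow> complex^'n::finite) \<Rightarrow> complex^('k \<Rightarrow> 'n)" where
  "kron_vec v = (\<chi> I. \<Prod>k\<in>UNIV. v k $ I k)"

abbreviation kron_power :: "complex^'n::finite \<Rightarrow> complex^('k::finite \<Rightarrow> 'n)" where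
  "kron_power x \<equiv> kron_vec (\<lambda>_. x)"

text \<open>The library has no multiplication of a complex matrix by a complex scalar.\<close>

definition smult_mat :: "complex \<Rightarrow> complex^'a::finite^'b::finite \<Rightarrow> complex^'a^'b"
    (infixr "*\<^sub>m" 75) where
  "c *\<^sub>m M = map_matrix (\<lambda>a. c * a) M"

text \<open>The rank-one matrix \<open>g s\<^sup>T\<close>, without conjugation. Likewise \<open>s\<^sup>T x\<close> is rendered below by
  \<open>scalar_product s x\<close>, which is bilinear, and not by the real inner product.\<close>

definition outer_prod :: "complex^'n::finite \<Rightarrow> complex^'n \<Rightarrow> complex^'n^'n" where
  "outer_prod g s = (\<chi> i j. g $ i * s $ j)"

definition operator_det ::
    "('k::finite \<Rightarrow> 'k \<Rightarrow> complex^'n::finite^'n) \<Rightarrow> complex^('k \<Rightarrow> 'n)^('k \<Rightarrow> 'n)" where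
  "operator_det D =
     (\<Sum>p | p permutes (UNIV :: 'k set). of_int (sign p) *\<^sub>m kron_mat (\<lambda>i. D i (p i)))"

fun array0 :: "complex^'n::finite^'n \<Rightarrow> ('m::finite \<Rightarrow> complex^'n^'n) \<Rightarrow>
    ('m \<Rightarrow> complex^'n) \<Rightarrow> ('m \<Rightarrow> complex^'n) \<Rightarrow>
    'm option \<Rightarrow> 'm option \<Rightarrow> complex^'n^'n" where
  "array0 B C s g _ None = B"
| "array0 B C s g None (Some j) = C j"
| "array0 B C s g (Some i) (Some j) = (if i = j then C j - outer_prod (g j) (s j) else C j)"

fun array1 :: "complex^'n::finite^'n \<Rightarrow> complex^'n^'n \<Rightarrow> ('m::finite \<Rightarrow> complex^'n^'n) \<Rightarrow>
    ('m \<Rightarrow> complex^'n) \<Rightarrow> ('m \<Rightarrow> complex^'n) \<Rightarrow> ('m \<Rightarrow> complex^'n) \<Rightarrow>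
    'm option \<Rightarrow> 'm option \<Rightarrow> complex^'n^'n" where
  "array1 A B C r s g None None = - A"
| "array1 A B C r s g (Some i) None = - (A + outer_prod (g i) (r i))"
| "array1 A B C r s g i (Some j) = array0 B C s g i (Some j)"

definition Delta0 :: "complex^'n::finite^'n \<Rightarrow> ('m::finite \<Rightarrow> complex^'n^'n) \<Rightarrow>
    ('m \<Rightarrow> complex^'n) \<Rightarrow> ('m \<Rightarrow> complex^'n) \<Rightarrow>
    complex^('m option \<Rightarrow> 'n)^('m option \<Rightarrow> 'n)" where
  "Delta0 B C s g = operator_det (array0 B C s g)"

definition Delta1 :: "complex^'n::finite^'n \<Rightarrow> complex^'n^'n \<Rightarrow> ('m::finite \<Rightarrow> complex^'n^'n) \<Rightarrow>
    ('m \<Rightarrow> complex^'n) \<Rightarrow> ('m \<Rightarrow> complex^'n) \<Rightarrow> ('m \<Rightarrow> complex^'n) \<Rightarrow>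
    complex^('m option \<Rightarrow> 'n)^('m option \<Rightarrow> 'n)" where
  "Delta1 A B C r s g = operator_det (array1 A B C r s g)"

definition nepv_solution :: "complex^'n::finite^'n \<Rightarrow> complex^'n^'n \<Rightarrow>
    ('m::finite \<Rightarrow> complex^'n^'n) \<Rightarrow> ('m \<Rightarrow> complex^'n) \<Rightarrow> ('m \<Rightarrow> complex^'n) \<Rightarrow>
    complex \<Rightarrow> complex^'n \<Rightarrow> bool" where
  "nepv_solution A B C r s \<mu> x \<longleftrightarrow>
     x \<noteq> 0 \<and> (\<forall>i. scalar_product (s i) x \<noteq> 0) \<and>
     (A + \<mu> *\<^sub>m B +
       (\<Sum>i\<in>UNIV. (scalar_product (r i) x / scalar_product (s i) x) *\<^sub>m C i)) *v x = 0"

definition same_solution :: "complex \<Rightarrow> complex^'n::finite \<Rightarrow> complex \<Rightarrow> complex^'n \<Rightarrow> bool" where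
  "same_solution \<nu> x \<mu> y \<longleftrightarrow> \<nu> = \<mu> \<and> (\<exists>\<alpha>. \<alpha> \<noteq> 0 \<and> y = \<alpha> *s x)"

definition nepv_solution_list :: "complex^'n::finite^'n \<Rightarrow> complex^'n^'n \<Rightarrow>
    ('m::finite \<Rightarrow> complex^'n^'n) \<Rightarrow> ('m \<Rightarrow> complex^'n) \<Rightarrow> ('m \<Rightarrow> complex^'n) \<Rightarrow>
    nat \<Rightarrow> (nat \<Rightarrow> complex) \<Rightarrow> (nat \<Rightarrow> complex^'n) \<Rightarrow> bool" where
  "nepv_solution_list A B C r s N lam x \<longleftrightarrow>
     (\<forall>j\<in>{1..N}. nepv_solution A B C r s (lam j) (x j)) \<and>
     (\<forall>i\<in>{1..N}. \<forall>j\<in>{1..N}. i \<noteq> j \<longrightarrow> \<not> same_solution (lam i) (x i) (lam j) (x j)) \<and>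
     (\<forall>\<mu> y. nepv_solution A B C r s \<mu> y \<longrightarrow> (\<exists>j\<in>{1..N}. same_solution (lam j) (x j) \<mu> y))"

definition pencil_eigenvector :: "complex^'a::finite^'a \<Rightarrow> complex^'a^'a \<Rightarrow>
    complex \<Rightarrow> complex^'a \<Rightarrow> bool" where
  "pencil_eigenvector M1 M0 \<mu> z \<longleftrightarrow> z \<noteq> 0 \<and> M1 *v z = \<mu> *s (M0 *v z)"

text \<open>Eigenvectors for the eigenvalue \<open>\<infinity>\<close>, which occur when \<open>M0\<close> is singular.\<close>

definition pencil_eigenvector_inf :: "complex^'a::finite^'a \<Rightarrow> complex^'a \<Rightarrow> bool" where
  "pencil_eigenvector_inf M0 z \<longleftrightarrow> z \<noteq> 0 \<and> M0 *v z = 0"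

definition pencil_eigenvalue :: "complex^'a::finite^'a \<Rightarrow> complex^'a^'a \<Rightarrow> complex \<Rightarrow> bool" where
  "pencil_eigenvalue M1 M0 \<mu> \<longleftrightarrow> (\<exists>z. pencil_eigenvector M1 M0 \<mu> z)"

definition regular_pencil :: "complex^'a::finite^'a \<Rightarrow> complex^'a^'a \<Rightarrow> bool" where
  "regular_pencil M1 M0 \<longleftrightarrow> (\<exists>\<mu>. det (M1 - \<mu> *\<^sub>m M0) \<noteq> 0)"

definition nondefective_pencil :: "complex^'a::finite^'a \<Rightarrow> complex^'a^'a \<Rightarrow> bool" where
  "nondefective_pencil M1 M0 \<longleftrightarrow>
     (\<exists>E. \<not> vec.dependent E \<and> vec.span E = UNIV \<and>
        (\<forall>z\<in>E. (\<exists>\<mu>. pencil_eigenvector M1 M0 \<mu> z) \<or> pencil_eigenvector_inf M0 z))"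

definition symmetric_decomposable :: "complex^('k::finite \<Rightarrow> 'n::finite) \<Rightarrow> bool" where
  "symmetric_decomposable z \<longleftrightarrow>
     (\<exists>(N::nat) \<alpha> y. z = (\<Sum>j<N. \<alpha> j *s kron_power (y j)))"

definition inverse_iteration :: "complex^'a::finite^'a \<Rightarrow> complex^'a^'a \<Rightarrow> complex \<Rightarrow>
    (nat \<Rightarrow> complex^'a) \<Rightarrow> (nat \<Rightarrow> complex^'a) \<Rightarrow> bool" where
  "inverse_iteration M1 M0 \<sigma> z zt \<longleftrightarrow>
     (\<forall>k. (M1 - \<sigma> *\<^sub>m M0) *v zt (Suc k) = M0 *v z k \<and>
          z (Suc k) = zt (Suc k) /\<^sub>R norm (zt (Suc k)))"

end

theory Submission
  imports Defs
begin

text \<open>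
  Put \<open>z\<^sub>j = x\<^sub>j \<otimes> \<dots> \<otimes> x\<^sub>j\<close>. A solution \<open>(\<lambda>, x)\<close> of the nonlinear problem solves the linear
  multiparameter eigenvalue problem with the parameters \<open>\<lambda>\<close> and \<open>\<mu>\<^sub>i = r\<^sub>i\<^sup>T x / s\<^sub>i\<^sup>T x\<close>, with
  the same vector \<open>x\<close> in every row. Every coordinate of an operator determinant applied to
  \<open>x \<otimes> \<dots> \<otimes> x\<close> is an ordinary scalar determinant, so Cramer's rule gives
  \<open>\<Delta>\<^sub>c z\<^sub>j = \<eta>\<^sub>j(c) \<Delta>\<^sub>0 z\<^sub>j\<close> not only for \<open>\<Delta>\<^sub>1\<close> but also for the operator determinant \<open>\<Delta>\<^sub>c\<close> that
  belongs to any other column \<open>c\<close>, where \<open>\<eta>\<^sub>j = (\<lambda>\<^sub>j, \<mu>\<^sub>j\<^sub>1, \<dots>, \<mu>\<^sub>j\<^sub>m)\<close>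
  (\<open>Delta_at_kron_power\<close>).

  The crux is that the \<open>z\<^sub>j\<close> span the whole symmetric space, even when several \<open>\<lambda>\<^sub>j\<close> coincide;
  otherwise the assumption on the components would say nothing about a starting vector outside
  their span. As
  \<open>\<sigma>\<close> is not an eigenvalue, \<open>P = (\<Delta>\<^sub>1 - \<sigma>\<Delta>\<^sub>0)\<^sup>-\<^sup>1\<close> exists, and the \<open>z\<^sub>j\<close> are joint eigenvectors of
  \<open>P\<Delta>\<^sub>0\<close> and of all \<open>P\<Delta>\<^sub>c\<close>, with the eigenvalues \<open>1 / (\<lambda>\<^sub>j - \<sigma>)\<close> and \<open>\<eta>\<^sub>j(c) / (\<lambda>\<^sub>j - \<sigma>)\<close>.
  These tuples determine \<open>\<eta>\<^sub>j\<close>. Distinct solutions have distinct \<open>\<eta>\<^sub>j\<close>, because for fixed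
  parameters all conditions on \<open>x\<close> are linear and two solutions would produce infinitely many
  (\<open>nepv_parameters_determine_solution\<close>). Hence the joint eigenvalue tuples are distinct and the
  \<open>z\<^sub>j\<close> are linearly independent (\<open>joint_eigenvectors_independent\<close>). The symmetric space is
  spanned by one vector per multiset of \<open>m + 1\<close> indices out of \<open>n\<close>, that is, by
  \<open>N\<^sub>s\<close> vectors, so the \<open>N\<^sub>s\<close> independent vectors \<open>z\<^sub>j\<close> span it
  (\<open>symmetric_decomposable_in_span\<close>).

  The starting vector is therefore a combination of eigenvectors of \<open>P\<Delta>\<^sub>0\<close> whose first
  coefficient is nonzero, and inverse iteration is normalised power iteration with \<open>P\<Delta>\<^sub>0\<close>. After
  division by the \<open>k\<close>-th power of the eigenvalue \<open>1 / (\<lambda>\<^sub>1 - \<sigma>)\<close>, all other components decay at least like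
  the \<open>k\<close>-th power of \<open>\<bar>(\<sigma> - \<lambda>\<^sub>1) / (\<sigma> - \<lambda>\<^sub>2)\<bar>\<close> (\<open>normalized_power_iteration_rate\<close>).
\<close>

section \<open>Linear algebra with complex scalars\<close>

lemma norm_vector_smult:
  fixes v :: "complex^'a::finite"
  shows "norm (c *s v) = cmod c * norm v"
  by (simp add: norm_vec_def norm_mult L2_set_right_distrib)

lemma smult_mat_vector_mult: "(c *\<^sub>m M) *v v = c *s (M *v v)"
  by (simp add: smult_mat_def map_matrix_def vec_eq_iff matrix_vector_mult_def sum_distrib_left mult.assoc)

lemma sum_matrix_vector_mult:
  fixes M :: "'b \<Rightarrow> complex^'a::finite^'c::finite"
  shows "(\<Sum>p\<in>S. M p) *v v = (\<Sum>p\<in>S. M p *v v)"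
  by (induction S rule: infinite_finite_induct) (simp_all add: matrix_vector_mult_add_rdistrib)

lemma matrix_vector_mult_sum:
  fixes M :: "complex^'a::finite^'c::finite"
  shows "M *v (\<Sum>p\<in>S. f p) = (\<Sum>p\<in>S. M *v f p)"
  by (induction S rule: infinite_finite_induct) (simp_all add: matrix_vector_right_distrib)

lemma uminus_matrix_vector_mult: "(- M) *v v = - (M *v (v :: complex^'a::finite))"
  by (simp add: vec_eq_iff matrix_vector_mult_def sum_negf)

lemma outer_prod_vector_mult: "outer_prod g s *v v = scalar_product s v *s g"
  by (simp add: vec_eq_iff outer_prod_def matrix_vector_mult_def scalar_product_def
      sum_distrib_left sum_distrib_right mult_ac)

lemma scalar_product_add_right: "scalar_product s (u + v) = scalar_product s u + scalar_product s v"
  for s :: "complex^'a::finite"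
  by (simp add: scalar_product_def algebra_simps sum.distrib)

lemma scalar_product_smult_right: "scalar_product s (c *s v) = c * scalar_product s v"
  for s :: "complex^'a::finite"
  by (simp add: scalar_product_def sum_distrib_left mult_ac)

section \<open>Cramer's rule for operator determinants\<close>

lemma kron_mat_vector_mult: "kron_mat M *v kron_vec v = kron_vec (\<lambda>k. M k *v v k)"
proof -
  have "(kron_mat M *v kron_vec v) $ I = kron_vec (\<lambda>k. M k *v v k) $ I" for I
  proof -
    have "(\<Prod>k\<in>UNIV. \<Sum>j\<in>UNIV. M k $ I k $ j * v k $ j)
        = (\<Sum>J\<in>PiE UNIV (\<lambda>_. UNIV). \<Prod>k\<in>UNIV. M k $ I k $ J k * v k $ J k)"
      by (rule prod_sum_PiE) auto
    then show ?thesis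
      by (simp add: kron_mat_def kron_vec_def matrix_vector_mult_def prod.distrib)
  qed
  then show ?thesis by (simp add: vec_eq_iff)
qed

text \<open>
  Because all factors of \<open>x \<otimes> \<dots> \<otimes> x\<close> are equal, fixing a coordinate \<open>I\<close> turns the Leibniz-type sum
  over permutations into the Leibniz formula for a scalar matrix. This makes scalar determinant
  theory available for operator determinants.
\<close>
lemma operator_det_kron_power_nth:
  "(operator_det D *v kron_power x) $ I = det (\<chi> i j. (D i j *v x) $ I i)"
proof -
  have "operator_det D *v kron_power x
      = (\<Sum>p | p permutes UNIV. of_int (sign p) *s kron_vec (\<lambda>i. D i (p i) *v x))"
    by (simp add: operator_det_def sum_matrix_vector_mult smult_mat_vector_mult kron_mat_vector_mult)
  then show ?thesis by (simp add: kron_vec_def det_def)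
qed

lemma operator_det_cramer:
  assumes "\<And>i. a i *v x = (\<Sum>j\<in>UNIV. \<eta> j *s (D i j *v x))"
  shows "operator_det (\<lambda>i j. if j = c then a i else D i j) *v kron_power x
       = \<eta> c *s (operator_det D *v kron_power x)"
proof -
  have "(operator_det (\<lambda>i j. if j = c then a i else D i j) *v kron_power x) $ I
      = \<eta> c * (operator_det D *v kron_power x) $ I" for I
  proof -
    let ?N = "(\<chi> i j. (D i j *v x) $ I i)"
    have "(?N *v (\<chi> j. \<eta> j)) $ i = (a i *v x) $ I i" for i
      by (simp add: assms matrix_vector_mult_def[of ?N] mult.commute)
    then have "det (\<chi> i j. ((if j = c then a i else D i j) *v x) $ I i)
        = det (\<chi> i j. if j = c then (?N *v (\<chi> j. \<eta> j)) $ i else ?N $ i $ j)"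
      by (intro arg_cong[of _ _ det]) (simp add: vec_eq_iff)
    also have "\<dots> = \<eta> c * det ?N"
      by (subst cramer_lemma) simp
    finally show ?thesis by (simp add: operator_det_kron_power_nth)
  qed
  then show ?thesis by (simp add: vec_eq_iff)
qed

section \<open>The linear multiparameter problem of a solution\<close>

definition rhs_column :: "complex^'n::finite^'n \<Rightarrow> ('m::finite \<Rightarrow> complex^'n) \<Rightarrow>
    ('m \<Rightarrow> complex^'n) \<Rightarrow> 'm option \<Rightarrow> complex^'n^'n" where
  "rhs_column A r g i = (case i of None \<Rightarrow> - A | Some j \<Rightarrow> - (A + outer_prod (g j) (r j)))"

text \<open>
  \<open>None\<close> yields \<open>\<Delta>\<^sub>1\<close>. The columns \<open>Some i\<close> yield the operator determinants that belong to the
  auxiliary parameters; they serve to separate solutions with the same \<open>\<lambda>\<close>.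
\<close>
definition Delta_at :: "'m option \<Rightarrow> complex^'n::finite^'n \<Rightarrow> complex^'n^'n \<Rightarrow>
    ('m::finite \<Rightarrow> complex^'n^'n) \<Rightarrow> ('m \<Rightarrow> complex^'n) \<Rightarrow> ('m \<Rightarrow> complex^'n) \<Rightarrow>
    ('m \<Rightarrow> complex^'n) \<Rightarrow> complex^('m option \<Rightarrow> 'n)^('m option \<Rightarrow> 'n)" where
  "Delta_at c A B C r s g =
     operator_det (\<lambda>i j. if j = c then rhs_column A r g i else array0 B C s g i j)"

definition nepv_parameter :: "('m::finite \<Rightarrow> complex^'n::finite) \<Rightarrow> ('m \<Rightarrow> complex^'n) \<Rightarrow>
    complex \<Rightarrow> complex^'n \<Rightarrow> 'm option \<Rightarrow> complex" where
  "nepv_parameter r s \<mu> x c =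
     (case c of None \<Rightarrow> \<mu> | Some i \<Rightarrow> scalar_product (r i) x / scalar_product (s i) x)"

lemma Delta1_eq_Delta_at: "Delta1 A B C r s g = Delta_at None A B C r s g"
proof -
  have "array1 A B C r s g
      = (\<lambda>i j. if j = None then rhs_column A r g i else array0 B C s g i j)"
  proof (intro ext)
    show "array1 A B C r s g i j = (if j = None then rhs_column A r g i else array0 B C s g i j)" for i j
      by (cases i; cases j) (auto simp: rhs_column_def)
  qed
  then show ?thesis by (simp only: Delta1_def Delta_at_def)
qed

lemma sum_option: "(\<Sum>c\<in>UNIV. f c) = f None + (\<Sum>i\<in>UNIV. f (Some i))"
  for f :: "'m::finite option \<Rightarrow> 'b::comm_monoid_add"
  by (simp add: UNIV_option_conv sum.reindex)

lemma nepv_solution_iff_vector: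
  "nepv_solution A B C r s \<mu> x \<longleftrightarrow> x \<noteq> 0 \<and> (\<forall>i. scalar_product (s i) x \<noteq> 0) \<and>
     A *v x + \<mu> *s (B *v x) + (\<Sum>i\<in>UNIV. nepv_parameter r s \<mu> x (Some i) *s (C i *v x)) = 0"
  by (simp add: nepv_solution_def nepv_parameter_def matrix_vector_mult_add_rdistrib
      smult_mat_vector_mult sum_matrix_vector_mult)

text \<open>
  In row \<open>Some k\<close> the two rank-one corrections cancel: \<open>g\<^sub>k r\<^sub>k\<^sup>T x\<close> equals
  \<open>\<mu>\<^sub>k g\<^sub>k s\<^sub>k\<^sup>T x\<close> by the choice of \<open>\<mu>\<^sub>k\<close>, and what is left is the nonlinear equation itself.
\<close>
lemma nepv_solution_rows:
  assumes "nepv_solution A B C r s \<mu> x"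
  shows "rhs_column A r g i *v x
       = (\<Sum>c\<in>UNIV. nepv_parameter r s \<mu> x c *s (array0 B C s g i c *v x))"
proof -
  let ?\<eta> = "nepv_parameter r s \<mu> x"
  have first: "- (A *v x) = \<mu> *s (B *v x) + (\<Sum>j\<in>UNIV. ?\<eta> (Some j) *s (C j *v x))"
    using assms by (simp add: nepv_solution_iff_vector add_eq_0_iff2 add.assoc minus_equation_iff)
  show ?thesis
  proof (cases i)
    case None
    then show ?thesis
      using first by (simp add: rhs_column_def sum_option uminus_matrix_vector_mult nepv_parameter_def)
  next
    case (Some k)
    have ratio: "?\<eta> (Some k) * scalar_product (s k) x = scalar_product (r k) x"
      using assms by (simp add: nepv_solution_def nepv_parameter_def)
    have "(\<Sum>j\<in>UNIV. ?\<eta> (Some j) *s (array0 B C s g (Some k) (Some j) *v x))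
        = (\<Sum>j\<in>UNIV. ?\<eta> (Some j) *s (C j *v x)
             - (if j = k then scalar_product (r k) x *s g k else 0))"
      using ratio by (intro sum.cong)
        (auto simp: matrix_vector_mult_diff_rdistrib outer_prod_vector_mult vec.scale_right_diff_distrib)
    also have "\<dots> = (\<Sum>j\<in>UNIV. ?\<eta> (Some j) *s (C j *v x)) - scalar_product (r k) x *s g k"
      by (simp add: sum_subtractf)
    finally show ?thesis
      using first Some
      by (simp add: rhs_column_def sum_option uminus_matrix_vector_mult nepv_parameter_def
          matrix_vector_mult_diff_rdistrib outer_prod_vector_mult)
  qed
qed

lemma Delta_at_kron_power:
  assumes "nepv_solution A B C r s \<mu> x"
  shows "Delta_at c A B C r s g *v kron_power x
       = nepv_parameter r s \<mu> x c *s (Delta0 B C s g *v kron_power x)"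
  unfolding Delta_at_def Delta0_def
  by (rule operator_det_cramer) (rule nepv_solution_rows[OF assms])

lemma kron_power_nonzero:
  assumes "x \<noteq> (0 :: complex^'n::finite)"
  shows "(kron_power x :: complex^('k::finite \<Rightarrow> 'n)) \<noteq> 0"
proof -
  obtain i where "x $ i \<noteq> 0" using assms by (auto simp: vec_eq_iff)
  then have "(kron_power x :: complex^('k \<Rightarrow> 'n)) $ (\<lambda>_. i) \<noteq> 0"
    by (simp add: kron_vec_def)
  then show ?thesis by auto
qed

section \<open>Independence of the symmetric eigenvectors\<close>

text \<open>
  The usual argument for one matrix, except that the matrix \<open>\<Gamma> c\<close> used to separate the new vector
  from an old one depends on the old one: \<open>\<Gamma> c - \<gamma> l c\<close> annihilates \<open>v l\<close> and multiplies the
  coefficient of \<open>v j\<close> by a nonzero factor.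
\<close>
lemma joint_eigenvectors_independent:
  fixes \<Gamma> :: "'c \<Rightarrow> complex^'a::finite^'a" and \<gamma> :: "'b \<Rightarrow> 'c \<Rightarrow> complex"
  assumes "finite J"
    and "\<And>j. j \<in> J \<Longrightarrow> v j \<noteq> 0"
    and "\<And>j c. j \<in> J \<Longrightarrow> \<Gamma> c *v v j = \<gamma> j c *s v j"
    and "inj_on \<gamma> J"
    and "(\<Sum>j\<in>J. a j *s v j) = 0" and "j \<in> J"
  shows "a j = 0"
  using assms
proof (induction J arbitrary: a j rule: finite_induct)
  case (insert l J)
  note eig = insert.prems(2)
  have zero: "a j = 0" if j: "j \<in> J" for j
  proof -
    obtain c where c: "\<gamma> j c \<noteq> \<gamma> l c"
      using insert.prems(3) insert.hyps(2) j by (metis ext inj_on_eq_iff insertCI)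
    have "0 = \<Gamma> c *v (\<Sum>i\<in>insert l J. a i *s v i) - \<gamma> l c *s (\<Sum>i\<in>insert l J. a i *s v i)"
      by (simp add: insert.prems(4))
    also have "\<dots> = (\<Sum>i\<in>insert l J. (a i * (\<gamma> i c - \<gamma> l c)) *s v i)"
      by (simp add: matrix_vector_mult_sum vec.scale_sum_right matrix_vector_mult_scaleR
          vec.scale eig algebra_simps vec.scale_left_diff_distrib flip: sum_subtractf)
    finally have "(\<Sum>i\<in>J. (a i * (\<gamma> i c - \<gamma> l c)) *s v i) = 0"
      using insert.hyps by simp
    moreover have "inj_on \<gamma> J" using insert.prems(3) by (simp add: inj_on_insert)
    ultimately have "a j * (\<gamma> j c - \<gamma> l c) = 0"
      using insert.IH[of "\<lambda>i. a i * (\<gamma> i c - \<gamma> l c)" j] insert.prems j by blast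
    then show ?thesis using c by simp
  qed
  then have "a l *s v l = 0"
    using insert.prems(4) insert.hyps by simp
  then have "a l = 0" using insert.prems(1)[of l] by simp
  then show ?case using zero insert.prems(5) by auto
qed simp

text \<open>
  With \<open>\<lambda>\<close> and all \<open>\<mu>\<^sub>i\<close> fixed, both the equation and the relations
  \<open>r\<^sub>i\<^sup>T x = \<mu>\<^sub>i s\<^sub>i\<^sup>T x\<close> are linear in \<open>x\<close>. If \<open>u\<close> and \<open>v\<close> are non-proportional solutions, then
  \<open>u + t v\<close> is a solution for every \<open>t\<close> at which no \<open>s\<^sub>i\<^sup>T (u + t v)\<close> vanishes, which excludes only finitely
  many \<open>t\<close>. These solutions are pairwise non-proportional and cannot fit into a finite list.
\<close>
lemma nepv_parameters_determine_solution:
  fixes A B :: "complex^'n::finite^'n" and C :: "'m::finite \<Rightarrow> complex^'n^'n"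
  assumes list: "nepv_solution_list A B C r s N lam x"
    and jl: "j \<in> {1..N}" "l \<in> {1..N}"
    and same: "nepv_parameter r s (lam j) (x j) = nepv_parameter r s (lam l) (x l)"
  shows "j = l"
proof (rule ccontr)
  assume "j \<noteq> l"
  define \<mu> where "\<mu> = lam j"
  define \<eta> where "\<eta> = nepv_parameter r s (lam j) (x j)"
  define u v where "u = x j" and "v = x l"
  have lam_l: "lam l = \<mu>"
    using fun_cong[OF same, of None] by (simp add: nepv_parameter_def \<mu>_def)
  have "nepv_solution A B C r s (lam i) (x i)" if "i \<in> {1..N}" for i
    using list that by (simp add: nepv_solution_list_def)
  from this[OF jl(1)] this[OF jl(2)]
  have sol: "nepv_solution A B C r s \<mu> u" "nepv_solution A B C r s \<mu> v"
    by (simp_all add: u_def v_def lam_l) (simp add: \<mu>_def)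
  have not_prop: "v \<noteq> \<alpha> *s u" for \<alpha>
  proof
    assume "v = \<alpha> *s u"
    moreover have "v \<noteq> 0" using sol(2) by (simp add: nepv_solution_def)
    ultimately have "same_solution (lam j) (x j) (lam l) (x l)"
      using lam_l by (auto simp: same_solution_def u_def v_def \<mu>_def)
    then show False using list jl \<open>j \<noteq> l\<close> by (auto simp: nepv_solution_list_def)
  qed
  have eta: "nepv_parameter r s \<mu> u = \<eta>" "nepv_parameter r s \<mu> v = \<eta>"
    using same lam_l by (simp_all add: \<eta>_def u_def v_def \<mu>_def)
  have ratio: "scalar_product (r i) w = \<eta> (Some i) * scalar_product (s i) w"
    if "w = u \<or> w = v" for w i
  proof -
    have "nepv_parameter r s \<mu> w (Some i) = \<eta> (Some i)" using eta that by auto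
    moreover have "scalar_product (s i) w \<noteq> 0" using sol that by (auto simp: nepv_solution_def)
    ultimately show ?thesis by (simp add: nepv_parameter_def divide_eq_eq)
  qed
  have linear: "A *v w + \<mu> *s (B *v w) + (\<Sum>i\<in>UNIV. \<eta> (Some i) *s (C i *v w)) = 0"
    if "w = u \<or> w = v" for w
    using sol eta that by (auto simp: nepv_solution_iff_vector)
  define T where "T = {t. \<forall>i. scalar_product (s i) (u + t *s v) \<noteq> 0}"
  have T_sol: "nepv_solution A B C r s \<mu> (u + t *s v)" if t: "t \<in> T" for t
  proof -
    let ?y = "u + t *s v"
    have s: "scalar_product (s i) ?y \<noteq> 0" for i using t by (simp add: T_def)
    \<comment> \<open>An index \<open>i\<close> exists because types are nonempty.\<close>
    have "?y \<noteq> 0"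
    proof
      assume "?y = 0"
      then show False using s[of undefined] by (simp only:) (simp add: scalar_product_def)
    qed
    moreover have "nepv_parameter r s \<mu> ?y (Some i) = \<eta> (Some i)" for i
      using s[of i] ratio[of u i] ratio[of v i]
      by (simp add: nepv_parameter_def divide_eq_eq scalar_product_add_right
          scalar_product_smult_right algebra_simps)
    moreover have "A *v ?y + \<mu> *s (B *v ?y) + (\<Sum>i\<in>UNIV. \<eta> (Some i) *s (C i *v ?y))
       = (A *v u + \<mu> *s (B *v u) + (\<Sum>i\<in>UNIV. \<eta> (Some i) *s (C i *v u)))
         + t *s (A *v v + \<mu> *s (B *v v) + (\<Sum>i\<in>UNIV. \<eta> (Some i) *s (C i *v v)))"
      by (simp add: matrix_vector_right_distrib vec.scale vec.scale_right_distrib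
          vec.scale_sum_right sum.distrib mult.commute)
    ultimately show ?thesis
      using s linear by (simp add: nepv_solution_iff_vector)
  qed
  have "finite (- T)"
  proof -
    have "- T \<subseteq> range (\<lambda>i. - scalar_product (s i) u / scalar_product (s i) v)"
    proof
      fix t assume "t \<in> - T"
      then obtain i where "scalar_product (s i) u + t * scalar_product (s i) v = 0"
        by (auto simp: T_def scalar_product_add_right scalar_product_smult_right)
      moreover have "scalar_product (s i) v \<noteq> 0" using sol(2) by (simp add: nepv_solution_def)
      ultimately have "t = - scalar_product (s i) u / scalar_product (s i) v"
        by (simp add: field_simps eq_neg_iff_add_eq_0 add.commute)
      then show "t \<in> range (\<lambda>i. - scalar_product (s i) u / scalar_product (s i) v)" by blast
    qed
    then show ?thesis by (rule finite_subset) simp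
  qed
  then have "infinite T"
    using infinite_UNIV_char_0[where 'a=complex] by (metis finite_UnI Compl_partition2 sup_commute)
  have "\<forall>t\<in>T. \<exists>i\<in>{1..N}. same_solution (lam i) (x i) \<mu> (u + t *s v)"
    using T_sol list by (auto simp: nepv_solution_list_def)
  then obtain f where f: "\<And>t. t \<in> T \<Longrightarrow> f t \<in> {1..N} \<and> same_solution (lam (f t)) (x (f t)) \<mu> (u + t *s v)"
    by metis
  have "inj_on f T"
  proof (rule inj_onI, rule ccontr)
    fix p q assume pq: "p \<in> T" "q \<in> T" "f p = f q" "p \<noteq> q"
    obtain a where a: "a \<noteq> 0" "u + p *s v = a *s x (f p)"
      using f[OF pq(1)] by (auto simp: same_solution_def)
    obtain b where b: "b \<noteq> 0" "u + q *s v = b *s x (f p)"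
      using f[OF pq(2)] pq(3) by (auto simp: same_solution_def)
    have "b *s (u + p *s v) = a *s (u + q *s v)"
      unfolding a(2) b(2) by (simp add: mult.commute)
    then have lin: "(b * p - a * q) *s v = (a - b) *s u"
      by (simp add: vec.scale_left_diff_distrib vec.scale_right_distrib) (simp add: algebra_simps vec_eq_iff)
    have "b * p - a * q = 0"
    proof (rule ccontr)
      assume ne: "b * p - a * q \<noteq> 0"
      then have "v = inverse (b * p - a * q) *s ((b * p - a * q) *s v)"
        by (simp only: vec.scale_scale left_inverse[OF ne] vec.scale_one)
      also have "\<dots> = (inverse (b * p - a * q) * (a - b)) *s u"
        by (simp only: lin vec.scale_scale)
      finally show False using not_prop by blast
    qed
    moreover have "a = b"
      using lin calculation sol(1) by (simp add: nepv_solution_def)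
    ultimately show False using b(1) pq(4) by (simp flip: right_diff_distrib)
  qed
  moreover have "f ` T \<subseteq> {1..N}" using f by blast
  ultimately show False using \<open>infinite T\<close> by (meson finite_atLeastAtMost inj_on_finite)
qed

section \<open>Dimension of the symmetric space\<close>

text \<open>
  The coordinate of \<open>y \<otimes> \<dots> \<otimes> y\<close> at \<open>I\<close> is a monomial in the entries of \<open>y\<close> that depends only on
  the multiset of the values of \<open>I\<close>. These vectors collect the coordinates with the same monomial.
\<close>
definition monomial_indicator :: "'n multiset \<Rightarrow> complex^('k::finite \<Rightarrow> 'n::finite)" where
  "monomial_indicator M = (\<chi> I. if image_mset I (mset_set UNIV) = M then 1 else 0)"

lemma kron_power_in_span_monomials:
  "(kron_power y :: complex^('k::finite \<Rightarrow> 'n::finite))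
     \<in> vec.span (monomial_indicator ` multisets_of_size UNIV CARD('k))"
proof -
  have "(kron_power y :: complex^('k \<Rightarrow> 'n)) $ I
      = (\<Sum>M\<in>multisets_of_size UNIV CARD('k). (\<Prod>i\<in>#M. y $ i) *s monomial_indicator M) $ I" for I
  proof -
    have "image_mset I (mset_set UNIV) \<in> multisets_of_size UNIV CARD('k)"
      by (simp add: multisets_of_size_def)
    moreover have "(kron_power y :: complex^('k \<Rightarrow> 'n)) $ I
        = (\<Prod>i\<in>#image_mset I (mset_set UNIV). y $ i)"
      by (simp add: kron_vec_def image_mset.compositionality comp_def prod_unfold_prod_mset)
    ultimately show ?thesis
      by (simp add: monomial_indicator_def finite_multisets_of_size if_distrib cong: if_cong)
  qed
  then have "kron_power y = (\<Sum>M\<in>multisets_of_size UNIV CARD('k).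
      (\<Prod>i\<in>#M. y $ i) *s (monomial_indicator M :: complex^('k \<Rightarrow> 'n)))"
    by (simp add: vec_eq_iff)
  then show ?thesis
    by (metis (no_types, lifting) vec.span_sum vec.span_scale vec.span_base imageI)
qed

text \<open>
  The monomial vectors bound the dimension of the symmetric space by the number of multisets, so
  that many independent symmetric vectors leave no room for a further one.
\<close>
lemma symmetric_decomposable_in_span:
  fixes v :: "'b \<Rightarrow> complex^('k::finite \<Rightarrow> 'n::finite)"
  assumes J: "finite J" "card J = (CARD('n) + CARD('k) - 1) choose CARD('k)"
    and sym: "\<And>j. j \<in> J \<Longrightarrow> symmetric_decomposable (v j)"
    and indep: "\<And>a j. (\<Sum>j\<in>J. a j *s v j) = 0 \<Longrightarrow> j \<in> J \<Longrightarrow> a j = 0"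
    and z: "symmetric_decomposable z"
  obtains \<alpha> where "z = (\<Sum>j\<in>J. \<alpha> j *s v j)"
proof -
  define E where "E = (monomial_indicator ` multisets_of_size UNIV CARD('k) :: (complex^('k \<Rightarrow> 'n)) set)"
  have E: "finite E" "card E \<le> card J"
    using J card_image_le[OF finite_multisets_of_size[of "UNIV :: 'n set" "CARD('k)"]]
    by (auto simp: E_def card_multisets_of_size intro!: finite_multisets_of_size)
  have in_span: "w \<in> vec.span E" if "symmetric_decomposable w" for w
    using that kron_power_in_span_monomials unfolding symmetric_decomposable_def E_def
    by (auto intro!: vec.span_sum vec.span_scale)
  have inj: "inj_on v J"
  proof (rule inj_onI, rule ccontr)
    fix p q assume pq: "p \<in> J" "q \<in> J" "v p = v q" "p \<noteq> q"
    have "(\<Sum>j\<in>J. ((if j = p then 1 else 0) - (if j = q then 1 else 0)) *s v j) = v p - v q"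
      using pq J by (simp add: vec.scale_left_diff_distrib sum_subtractf if_distrib[of "\<lambda>c. c *s _"] cong: if_cong)
    also have "\<dots> = 0" using pq(3) by simp
    finally have "(if p = p then 1 else 0) - (if p = q then 1 else 0) = (0::complex)"
      by (rule indep[OF _ pq(1)])
    then show False using pq(4) by simp
  qed
  have ind: "\<not> vec.dependent (v ` J)"
  proof (rule vec.independent_if_scalars_zero)
    fix f w assume f: "(\<Sum>w\<in>v ` J. f w *s w) = 0" and w: "w \<in> v ` J"
    then show "f w = 0" using indep[of "\<lambda>j. f (v j)"] by (auto simp: sum.reindex[OF inj])
  qed (use J in simp)
  have "z \<in> vec.span (v ` J)"
  proof (rule ccontr)
    assume z': "z \<notin> vec.span (v ` J)"
    then have "\<not> vec.dependent (insert z (v ` J))" using ind by (rule vec.independent_insertI)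
    moreover have "insert z (v ` J) \<subseteq> vec.span E" using in_span sym z by auto
    ultimately have "card (insert z (v ` J)) \<le> card E"
      using vec.independent_span_bound[OF E(1)] by blast
    moreover have "z \<notin> v ` J" using z' vec.span_base by blast
    ultimately show False using J E by (simp add: card_image[OF inj])
  qed
  then obtain u where "z = (\<Sum>w\<in>v ` J. u w *s w)"
    using J by (auto simp: vec.span_finite)
  then show ?thesis using that[of "\<lambda>j. u (v j)"] by (simp add: sum.reindex[OF inj])
qed

section \<open>Convergence of normalised power iteration\<close>

text \<open>
  Whatever scalars are used for the normalisation, \<open>z k\<close> is a multiple \<open>d k\<close> of
  \<open>\<alpha> p v p + rest k\<close>, where \<open>rest k\<close> has norm at most a constant times \<open>\<rho>\<^sup>k\<close>. For \<open>\<rho> < 1\<close> the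
  bracket stays away from \<open>0\<close>, so boundedness of \<open>z k\<close> bounds \<open>d k\<close>, and the distance to the line
  is at most \<open>\<bar>d k\<bar>\<close> times the norm of \<open>rest k\<close>. For \<open>\<rho> = 1\<close> only boundedness is claimed.
\<close>
lemma normalized_power_iteration_rate:
  fixes T :: "complex^'a::finite^'a" and v :: "'b \<Rightarrow> complex^'a" and \<rho> :: real
  assumes J: "finite J" "p \<notin> J"
    and eig: "\<And>j. j \<in> insert p J \<Longrightarrow> T *v v j = \<theta> j *s v j"
    and p: "\<theta> p \<noteq> 0" "\<alpha> p *s v p \<noteq> 0"
    and \<rho>: "\<And>j. j \<in> J \<Longrightarrow> cmod (\<theta> j) \<le> \<rho> * cmod (\<theta> p)" "0 \<le> \<rho>" "\<rho> \<le> 1"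
    and z0: "z 0 = (\<Sum>j\<in>insert p J. \<alpha> j *s v j)"
    and step: "\<And>k. \<exists>c. z (Suc k) = c *s (T *v z k)"
    and bound: "\<And>k. norm (z k) \<le> R"
  shows "(\<lambda>k. infdist (z k) (vec.span {v p})) \<in> O(\<lambda>k. \<rho> ^ k)"
proof (cases "\<rho> = 1")
  case True
  have "infdist (z k) (vec.span {v p}) \<le> R" for k
    using infdist_le[OF vec.span_zero, of "z k" "{v p}"] bound[of k] by simp
  then show ?thesis
    using True by (intro bigoI[where c = R]) (simp add: infdist_nonneg)
next
  case False
  then have \<rho>1: "\<rho> < 1" using \<rho> by simp
  define rest where "rest k = (\<Sum>j\<in>J. (\<alpha> j * (\<theta> j / \<theta> p) ^ k) *s v j)" for k
  define S where "S = (\<Sum>j\<in>J. cmod (\<alpha> j) * norm (v j))"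
  have T_step: "T *v (\<alpha> p *s v p + rest k) = \<theta> p *s (\<alpha> p *s v p + rest (Suc k))" for k
    using p eig
    by (simp add: rest_def matrix_vector_right_distrib matrix_vector_mult_sum vec.scale
        vec.scale_right_distrib vec.scale_sum_right mult_ac)
  have "\<exists>d. z k = d *s (\<alpha> p *s v p + rest k)" for k
  proof (induction k)
    case 0
    show ?case using z0 J by (intro exI[of _ 1]) (simp add: rest_def)
  next
    case (Suc k)
    then obtain d c where "z k = d *s (\<alpha> p *s v p + rest k)" "z (Suc k) = c *s (T *v z k)"
      using step by blast
    then have "z (Suc k) = (c * d * \<theta> p) *s (\<alpha> p *s v p + rest (Suc k))"
      by (simp only: vec.scale T_step vec.scale_scale mult.assoc)
    then show ?case by blast
  qed
  then obtain d where d: "\<And>k. z k = d k *s (\<alpha> p *s v p + rest k)" by metis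
  have rest_le: "norm (rest k) \<le> S * \<rho> ^ k" for k
  proof -
    have "norm (rest k) \<le> (\<Sum>j\<in>J. norm ((\<alpha> j * (\<theta> j / \<theta> p) ^ k) *s v j))"
      unfolding rest_def by (rule norm_sum)
    also have "\<dots> \<le> (\<Sum>j\<in>J. cmod (\<alpha> j) * norm (v j) * \<rho> ^ k)"
    proof (rule sum_mono)
      fix j assume "j \<in> J"
      then have ratio: "cmod (\<theta> j / \<theta> p) ^ k \<le> \<rho> ^ k"
        using \<rho>(1)[of j] p by (intro power_mono) (simp_all add: norm_divide divide_le_eq)
      have "norm ((\<alpha> j * (\<theta> j / \<theta> p) ^ k) *s v j)
          = cmod (\<alpha> j) * norm (v j) * cmod (\<theta> j / \<theta> p) ^ k"
        by (simp only: norm_vector_smult norm_mult norm_power mult_ac)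
      also have "\<dots> \<le> cmod (\<alpha> j) * norm (v j) * \<rho> ^ k"
        using ratio by (intro mult_left_mono) simp_all
      finally show "norm ((\<alpha> j * (\<theta> j / \<theta> p) ^ k) *s v j) \<le> cmod (\<alpha> j) * norm (v j) * \<rho> ^ k" .
    qed
    finally show ?thesis by (simp add: S_def sum_distrib_right)
  qed
  define L where "L = norm (\<alpha> p *s v p)"
  have L: "L > 0" using p by (simp add: L_def)
  have "(\<lambda>k. S * \<rho> ^ k) \<longlonglongrightarrow> 0"
    using \<rho> \<rho>1 by (intro tendsto_mult_right_zero LIMSEQ_power_zero) simp
  then have "\<forall>\<^sub>F k in sequentially. S * \<rho> ^ k < L / 2"
    by (rule order_tendstoD(2)) (use L in simp)
  then have "\<forall>\<^sub>F k in sequentially. infdist (z k) (vec.span {v p}) \<le> (2 * R / L * S) * \<rho> ^ k"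
  proof eventually_elim
    case (elim k)
    have "L \<le> norm (\<alpha> p *s v p + rest k) + norm (rest k)"
      unfolding L_def using norm_triangle_ineq4[of "\<alpha> p *s v p + rest k" "rest k"] by simp
    then have "L / 2 \<le> norm (\<alpha> p *s v p + rest k)" using rest_le[of k] elim by linarith
    then have "cmod (d k) * (L / 2) \<le> norm (z k)"
      unfolding d norm_vector_smult by (intro mult_left_mono) simp_all
    then have dk: "cmod (d k) \<le> 2 * R / L" using bound[of k] L by (simp add: field_simps)
    have "d k *s (\<alpha> p *s v p) \<in> vec.span {v p}"
      by (intro vec.span_scale vec.span_base) simp
    moreover have "dist (z k) (d k *s (\<alpha> p *s v p)) = cmod (d k) * norm (rest k)"
      unfolding dist_norm d vec.scale_right_distrib by (simp add: norm_vector_smult)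
    ultimately have "infdist (z k) (vec.span {v p}) \<le> cmod (d k) * norm (rest k)"
      using infdist_le by metis
    also have "\<dots> \<le> (2 * R / L) * (S * \<rho> ^ k)"
      using dk rest_le[of k] order_trans[OF norm_ge_zero dk] by (intro mult_mono) simp_all
    finally show ?case by (simp add: mult.assoc)
  qed
  then show ?thesis
    by (intro bigoI[where c = "2 * R / L * S"]) (simp add: infdist_nonneg \<rho>)
qed

section \<open>Inverse iteration on the symmetric space\<close>

theorem theorem4p8:
  fixes A B :: "complex^'n::finite^'n"
    and C :: "'m::finite \<Rightarrow> complex^'n^'n"
    and r s g :: "'m \<Rightarrow> complex^'n"
    and lam :: "nat \<Rightarrow> complex"
    and x :: "nat \<Rightarrow> complex^'n"
    and \<sigma> :: complex
    and z zt :: "nat \<Rightarrow> complex^('m option \<Rightarrow> 'n)"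
    and Ns :: nat
  assumes "CARD('n) \<ge> 2"
    and "\<And>i. g i \<noteq> 0"
    and "Ns = (CARD('n) + CARD('m)) choose (CARD('m) + 1)"
    and "nepv_solution_list A B C r s Ns lam x"
    and "regular_pencil (Delta1 A B C r s g) (Delta0 B C s g)"
    and "nondefective_pencil (Delta1 A B C r s g) (Delta0 B C s g)"
    and "\<not> pencil_eigenvalue (Delta1 A B C r s g) (Delta0 B C s g) \<sigma>"
    and "\<And>i j. 1 \<le> i \<Longrightarrow> i \<le> j \<Longrightarrow> j \<le> Ns \<Longrightarrow> cmod (lam i - \<sigma>) \<le> cmod (lam j - \<sigma>)"
    and "symmetric_decomposable (z 0)"
    and "\<And>\<alpha>. z 0 = (\<Sum>j=1..Ns. \<alpha> j *s kron_power (x j)) \<Longrightarrow> \<alpha> 1 \<noteq> 0 \<and> \<alpha> 2 \<noteq> 0"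
    and "inverse_iteration (Delta1 A B C r s g) (Delta0 B C s g) \<sigma> z zt"
  shows "(\<lambda>k. infdist (z k) (vec.span {kron_power (x 1)}))
           \<in> O(\<lambda>k. cmod ((\<sigma> - lam 1) / (\<sigma> - lam 2)) ^ k)"
proof -
  let ?D = "\<lambda>c. Delta_at c A B C r s g" and ?M = "Delta0 B C s g"
  let ?v = "\<lambda>j. kron_power (x j) :: complex^('m option \<Rightarrow> 'n)"
  let ?\<eta> = "\<lambda>j. nepv_parameter r s (lam j) (x j)"
  have Ns2: "2 \<le> Ns"
  proof -
    have "2 \<le> (CARD('m) + 2) choose (CARD('m) + 1)" by simp
    also have "\<dots> \<le> Ns" unfolding assms(3) using assms(1) by (intro binomial_right_mono) simp
    finally show ?thesis .
  qed
  have sol: "nepv_solution A B C r s (lam j) (x j)" if "j \<in> {1..Ns}" for j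
    using assms(4) that by (simp add: nepv_solution_list_def)
  have v_nz: "?v j \<noteq> 0" if "j \<in> {1..Ns}" for j
    using sol[OF that] by (simp add: nepv_solution_def kron_power_nonzero)
  have D_v: "?D c *v ?v j = ?\<eta> j c *s (?M *v ?v j)" if "j \<in> {1..Ns}" for j c
    using Delta_at_kron_power[OF sol[OF that]] .
  have D1_v: "Delta1 A B C r s g *v ?v j = lam j *s (?M *v ?v j)" if "j \<in> {1..Ns}" for j
    using D_v[OF that, of None] by (simp add: Delta1_eq_Delta_at nepv_parameter_def)
  have lam_ne: "lam j \<noteq> \<sigma>" if "j \<in> {1..Ns}" for j
    using D1_v[OF that] v_nz[OF that] assms(7)
    by (auto simp: pencil_eigenvalue_def pencil_eigenvector_def)
  let ?S = "Delta1 A B C r s g - \<sigma> *\<^sub>m ?M"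
  have S_mult: "?S *v w = Delta1 A B C r s g *v w - \<sigma> *s (?M *v w)" for w
    by (simp add: matrix_vector_mult_diff_rdistrib smult_mat_vector_mult)
  have "\<forall>w. ?S *v w = 0 \<longrightarrow> w = 0"
    using assms(7) by (auto simp: S_mult pencil_eigenvalue_def pencil_eigenvector_def)
  then obtain P where P: "P ** ?S = mat 1"
    unfolding matrix_left_invertible_ker[symmetric] by blast
  have P_S: "P *v (?S *v w) = w" for w
    by (simp add: matrix_vector_mul_assoc P)
  have D0_v: "P *v (?M *v ?v j) = (1 / (lam j - \<sigma>)) *s ?v j" if j: "j \<in> {1..Ns}" for j
  proof -
    have "?v j = (lam j - \<sigma>) *s (P *v (?M *v ?v j))"
      using P_S[of "?v j"]
      by (simp only: S_mult D1_v[OF j] vec.scale flip: vec.scale_left_diff_distrib)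
    then have "(1 / (lam j - \<sigma>)) *s ?v j = (1 / (lam j - \<sigma>)) *s ((lam j - \<sigma>) *s (P *v (?M *v ?v j)))"
      by (rule arg_cong)
    also have "\<dots> = P *v (?M *v ?v j)"
      using lam_ne[OF j] by (simp only: vec.scale_scale) simp
    finally show ?thesis ..
  qed
  \<comment> \<open>\<open>\<Gamma> None\<close> is built from \<open>\<Delta>\<^sub>0\<close> rather than \<open>\<Delta>\<^sub>1\<close>: it is the matrix of the iteration, and its
    eigenvalue \<open>1 / (\<lambda> - \<sigma>)\<close> already determines \<open>\<lambda>\<close>.\<close>
  define \<Gamma> where "\<Gamma> c = P ** (case c of None \<Rightarrow> ?M | Some i \<Rightarrow> ?D (Some i))" for c
  define \<gamma> where "\<gamma> j c = (case c of None \<Rightarrow> 1 | Some i \<Rightarrow> ?\<eta> j (Some i)) / (lam j - \<sigma>)" for j c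
  have \<Gamma>_v: "\<Gamma> c *v ?v j = \<gamma> j c *s ?v j" if j: "j \<in> {1..Ns}" for j c
    using D0_v[OF j] D_v[OF j]
    by (cases c) (simp_all add: \<Gamma>_def \<gamma>_def vec.scale flip: matrix_vector_mul_assoc)
  have "inj_on \<gamma> {1..Ns}"
  proof (rule inj_onI)
    fix j l assume jl: "j \<in> {1..Ns}" "l \<in> {1..Ns}" and eq: "\<gamma> j = \<gamma> l"
    have lam: "lam j = lam l"
      using fun_cong[OF eq, of None] by (simp add: \<gamma>_def divide_inverse)
    have "?\<eta> j (Some i) = ?\<eta> l (Some i)" for i
    proof -
      have "?\<eta> j (Some i) = \<gamma> j (Some i) * (lam j - \<sigma>)"
        and "?\<eta> l (Some i) = \<gamma> l (Some i) * (lam l - \<sigma>)"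
        using lam_ne[OF jl(1)] lam_ne[OF jl(2)] by (simp_all add: \<gamma>_def)
      then show ?thesis by (simp only: eq lam)
    qed
    then have "?\<eta> j c = ?\<eta> l c" for c
      by (cases c) (simp_all add: lam nepv_parameter_def)
    then have "?\<eta> j = ?\<eta> l" by blast
    then show "j = l" by (rule nepv_parameters_determine_solution[OF assms(4) jl])
  qed
  then have indep: "a j = 0" if "(\<Sum>j\<in>{1..Ns}. a j *s ?v j) = 0" "j \<in> {1..Ns}" for a j
    using joint_eigenvectors_independent[of "{1..Ns}" ?v \<Gamma> \<gamma> a j] v_nz \<Gamma>_v that by blast
  have v_sym: "symmetric_decomposable (?v j)" for j
    unfolding symmetric_decomposable_def
    by (intro exI[of _ 1] exI[of _ "\<lambda>_. 1"] exI[of _ "\<lambda>_. x j"]) simp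
  have "card {1..Ns} = (CARD('n) + CARD('m option) - 1) choose CARD('m option)"
    by (simp add: assms(3) card_UNIV_option)
  then obtain \<alpha> where \<alpha>: "z 0 = (\<Sum>j=1..Ns. \<alpha> j *s ?v j)"
    using symmetric_decomposable_in_span[of "{1..Ns}" ?v "z 0"] v_sym indep assms(9) by blast
  define \<rho> where "\<rho> = cmod ((\<sigma> - lam 1) / (\<sigma> - lam 2))"
  have split: "{1..Ns} = insert 1 {2..Ns}" using Ns2 by auto
  have zt: "zt (Suc k) = \<Gamma> None *v z k" for k
    using assms(11) P_S[of "zt (Suc k)"]
    by (simp add: inverse_iteration_def \<Gamma>_def flip: matrix_vector_mul_assoc)
  have z_Suc: "z (Suc k) = zt (Suc k) /\<^sub>R norm (zt (Suc k))" for k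
    using assms(11) by (simp add: inverse_iteration_def)
  have "(\<lambda>k. infdist (z k) (vec.span {?v 1})) \<in> O(\<lambda>k. \<rho> ^ k)"
  proof (rule normalized_power_iteration_rate[where T = "\<Gamma> None" and J = "{2..Ns}"
        and \<theta> = "\<lambda>j. \<gamma> j None" and \<alpha> = \<alpha> and R = "max 1 (norm (z 0))"])
    show "\<Gamma> None *v ?v j = \<gamma> j None *s ?v j" if "j \<in> insert 1 {2..Ns}" for j
      using that \<Gamma>_v unfolding split by blast
    show "\<gamma> 1 None \<noteq> 0" using lam_ne[of 1] Ns2 by (simp add: \<gamma>_def)
    show "\<alpha> 1 *s ?v 1 \<noteq> 0" using assms(10)[OF \<alpha>] v_nz[of 1] Ns2 by simp
    show "cmod (\<gamma> j None) \<le> \<rho> * cmod (\<gamma> 1 None)" if j: "j \<in> {2..Ns}" for j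
    proof -
      have "cmod (lam 2 - \<sigma>) \<le> cmod (lam j - \<sigma>)" using assms(8)[of 2 j] j by simp
      moreover have "lam 1 \<noteq> \<sigma>" "lam 2 \<noteq> \<sigma>" "lam j \<noteq> \<sigma>" using lam_ne j Ns2 by auto
      ultimately show ?thesis
        by (simp add: \<gamma>_def \<rho>_def norm_divide norm_minus_commute[of \<sigma>] field_simps)
    qed
    show "\<rho> \<le> 1"
      using assms(8)[of 1 2] Ns2
      by (simp add: \<rho>_def norm_divide norm_minus_commute[of \<sigma>] divide_le_eq_1)
    show "z 0 = (\<Sum>j\<in>insert 1 {2..Ns}. \<alpha> j *s ?v j)" using \<alpha> unfolding split .
    show "\<exists>c. z (Suc k) = c *s (\<Gamma> None *v z k)" for k
      unfolding z_Suc zt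
      by (intro exI[of _ "complex_of_real (inverse (norm (\<Gamma> None *v z k)))"])
         (simp add: vec_eq_iff scaleR_conv_of_real[where 'a = complex])
    show "norm (z k) \<le> max 1 (norm (z 0))" for k
    proof (cases k)
      case (Suc l)
      have "norm (z k) \<le> 1"
        unfolding Suc z_Suc by (cases "norm (zt (Suc l)) = 0") simp_all
      then show ?thesis by simp
    qed simp
  qed (simp_all add: \<rho>_def)
  then show ?thesis by (simp add: \<rho>_def)
qed

end
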